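(* Let $k\ge 1$ and $n\ge 0$ be integers, let $A$ be a set of positive integers, and let $c=(c_a)_{a\ge 1}$ be a sequence of nonnegative integers such that $c_a=0$ exactly when $a\notin A$. Let $m,\ell\ge 0$ and $0\le r\le k-1$ be integers such that $m=\ell k+r$. Then: (1) the $(r+1)$-tuple of statistics $(\mathrm{wpk}^*_0,\dots,\mathrm{wpk}^*_r)$ on $\mathcal{P}^{k,A,c,m}_n$ is jointly equidistributed with any of its permutations; (2) the $(k-r-1)$-tuple of statistics $(\mathrm{wpk}^*_{r+1},\dots,\mathrm{wpk}^*_{k-1})$ on $\mathcal{P}^{k,A,c,m}_n$ is jointly equidistributed with any of its permutations.
   Context: A $(k,A,c,m)$-path is a lattice path starting at $(0,0)$, ending at height $m$, and staying in the first quadrant (never going below the $x$-axis), with steps $u=(1,1)$, $d=(1,-k)$ and, for each $a\in A$ and each color $b$ with $1\le b\le c_a$, a level step $l_{a,b}=(a,0)$ of color $b$ (no level steps if $A=\emptyset$). Level steps with different $(a,b)$ are distinct, and paths are identified with their step sequences. Step lengths are $|u|=1$, $|d|=1$, $|l_{a,b}|=a$, and the length $|P|$ of a path is the sum of the lengths of its steps. $\mathcal{P}^{k,A,c,m}_n$ is the set of $(k,A,c,m)$-paths of length $n$. A weak peak of $P$ is a block of two consecutive steps of the form $ud$ or $ul_{a,b}$, or the single step $l_{a,b}$ if it is the leftmost (first) step of $P$ (here $a\in A$, $1\le b\le c_a$). The height of a weak peak is the second coordinate of the left endpoint of its down-step or level step. For $0\le i\le k-1$, $\mathrm{wpk}^*_i(P)$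 is the number of all weak peaks of $P$ (including the rightmost one) whose height is congruent to $i$ modulo $k$. A tuple of statistics $(s_1,\dots,s_t)$ on a finite set $S$ is jointly equidistributed with any of its permutations if for every permutation $\sigma$ of $\{1,\dots,t\}$ and all integers $v_1,\dots,v_t$, the number of $P\in S$ with $s_j(P)=v_j$ for all $j$ equals the number of $P\in S$ with $s_{\sigma(j)}(P)=v_j$ for all $j$ (vacuous if $t=0$). *)

theory Defs
  imports "HOL-Library.Product_Plus" "HOL-Number_Theory.Cong" "HOL-Combinatorics.Permutations"
begin

text \<open>The step \<open>Level a b\<close> is the level step of length \<open>a\<close> and color \<open>b\<close>.\<close>

datatype step = Up | Down | Level nat nat

fun step_vec :: "nat \<Rightarrow> step \<Rightarrow> int \<times> int" where
  "step_vec k Up = (1, 1)"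
| "step_vec k Down = (1, - int k)"
| "step_vec k (Level a b) = (int a, 0)"

fun step_length :: "step \<Rightarrow> nat" where
  "step_length Up = 1"
| "step_length Down = 1"
| "step_length (Level a b) = a"

fun admissible_step :: "nat set \<Rightarrow> (nat \<Rightarrow> nat) \<Rightarrow> step \<Rightarrow> bool" where
  "admissible_step A c Up \<longleftrightarrow> True"
| "admissible_step A c Down \<longleftrightarrow> True"
| "admissible_step A c (Level a b) \<longleftrightarrow> a \<in> A \<and> 1 \<le> b \<and> b \<le> c a"

definition path_length :: "step list \<Rightarrow> nat" where
  "path_length P = sum_list (map step_length P)"

text \<open>The lattice point reached from the origin after the first \<open>j\<close> steps of \<open>P\<close>.\<close>

definition vertex :: "nat \<Rightarrow> step list \<Rightarrow> nat \<Rightarrow> int \<times> int" where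
  "vertex k P j = sum_list (map (step_vec k) (take j P))"

definition is_path :: "nat \<Rightarrow> nat set \<Rightarrow> (nat \<Rightarrow> nat) \<Rightarrow> nat \<Rightarrow> step list \<Rightarrow> bool" where
  "is_path k A c m P \<longleftrightarrow>
     (\<forall>s \<in> set P. admissible_step A c s) \<and>
     (\<forall>j \<le> length P. 0 \<le> fst (vertex k P j) \<and> 0 \<le> snd (vertex k P j)) \<and>
     snd (vertex k P (length P)) = int m"

definition paths :: "nat \<Rightarrow> nat set \<Rightarrow> (nat \<Rightarrow> nat) \<Rightarrow> nat \<Rightarrow> nat \<Rightarrow> step list set" where
  "paths k A c m n = {P. is_path k A c m P \<and> path_length P = n}"

text \<open>
  A weak peak is encoded by the (0-based) index of its down-step or level step. This is
  unambiguous, as a level step that starts the path is not preceded by an up-step.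
\<close>

definition weak_peak_at :: "step list \<Rightarrow> nat \<Rightarrow> bool" where
  "weak_peak_at P j \<longleftrightarrow> j < length P \<and>
     ((\<exists>i. j = Suc i \<and> P ! i = Up \<and> (P ! j = Down \<or> (\<exists>a b. P ! j = Level a b))) \<or>
      (j = 0 \<and> (\<exists>a b. P ! j = Level a b)))"

text \<open>The left endpoint of the step with index \<open>j\<close> is \<open>vertex k P j\<close>.\<close>

definition wpk :: "nat \<Rightarrow> nat \<Rightarrow> step list \<Rightarrow> nat" where
  "wpk k i P = card {j. weak_peak_at P j \<and> [snd (vertex k P j) = int i] (mod int k)}"

text \<open>A tuple of statistics is a list, indexed from \<open>0\<close>.\<close>

definition jointly_equidistributed :: "('p \<Rightarrow> int) list \<Rightarrow> 'p set \<Rightarrow> bool" where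
  "jointly_equidistributed ss S \<longleftrightarrow>
     (\<forall>\<sigma>. \<sigma> permutes {..<length ss} \<longrightarrow>
       (\<forall>v :: nat \<Rightarrow> int.
          card {P \<in> S. \<forall>j < length ss. (ss ! j) P = v j} =
          card {P \<in> S. \<forall>j < length ss. (ss ! \<sigma> j) P = v j}))"

text \<open>Finiteness ensures that the cardinalities above are genuine counts.\<close>

lemma finite_weak_peaks: "finite {j. weak_peak_at P j}"
  by (rule finite_subset[of _ "{..<length P}"]) (auto simp: weak_peak_at_def)

lemma finite_paths:
  assumes "\<forall>a \<in> A. a > 0"
  shows "finite (paths k A c m n)"
proof -
  let ?S = "{Up, Down} \<union> (\<Union>a \<in> {..n}. Level a ` {..c a})"
  have len: "length P \<le> path_length P" if "\<forall>s \<in> set P. admissible_step A c s" for P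
    using that
  proof (induction P)
    case (Cons s P)
    then have "1 \<le> step_length s"
      using assms by (cases s) (auto simp: Suc_le_eq)
    with Cons show ?case by (simp add: path_length_def)
  qed (simp add: path_length_def)
  have "set P \<subseteq> ?S \<and> length P \<le> n" if P: "P \<in> paths k A c m n" for P
  proof -
    have adm: "\<forall>s \<in> set P. admissible_step A c s" and n: "path_length P = n"
      using P by (auto simp: paths_def is_path_def)
    have "s \<in> ?S" if s: "s \<in> set P" for s
    proof -
      have "step_length s \<le> n"
        using s n by (auto simp: path_length_def intro: member_le_sum_list)
      then show ?thesis using adm s by (cases s) fastforce+
    qed
    then show ?thesis using len[OF adm] n by auto
  qed
  then have "paths k A c m n \<subseteq> {P. set P \<subseteq> ?S \<and> length P \<le> n}" by blast
  moreover have "finite {P. set P \<subseteq> ?S \<and> length P \<le> n}"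
    by (rule finite_lists_length_le) auto
  ultimately show ?thesis by (rule finite_subset)
qed

end

theory Submission
  imports Defs
begin

text \<open>
  Cutting a path at its up-steps writes it uniquely as \<open>w\<^sub>0 u w\<^sub>1 u \<dots> u w\<^sub>N\<close>, where each block
  \<open>w\<^sub>j\<close> is a word in down-steps and level steps. Such steps do not change the height modulo \<open>k\<close>,
  so all vertices in \<open>w\<^sub>j\<close> have height congruent to \<open>j\<close>. A weak peak is exactly the first step of a
  nonempty block (\<open>w\<^sub>0\<close> cannot start with a down-step), so the statistic for the residue \<open>i\<close>
  counts the nonempty blocks \<open>w\<^sub>j\<close> with \<open>j mod k = i\<close> (\<open>wpk_eq_card_block_set\<close>).

  In terms of the blocks, the path stays in the first quadrant iff, for every \<open>j\<close>, the number of
  down-steps in \<open>w\<^sub>0, \<dots>, w\<^sub>j\<close> is at most \<open>j div k\<close>, and it ends at height \<open>m\<close> iff \<open>N\<close> is \<open>m\<close> plus \<open>k\<close>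
  times the total number of down-steps (\<open>mem_paths_iff\<close>); in particular \<open>N mod k = r\<close>. Arrange the
  indices \<open>0, \<dots>, N\<close> in rows of length \<open>k\<close>. The bound \<open>j div k\<close> is constant on a row, and the
  number of down-steps grows with \<open>j\<close>, so only the totals at the ends of the rows matter; hence
  blocks may be permuted freely inside each row. The last row consists of the columns \<open>0, \<dots>, r\<close>
  only. Therefore any permutation of the columns that preserves \<open>{0, \<dots>, r}\<close>, applied in all
  rows at once, is a bijection on the set of paths (\<open>permute_blocks_in_paths\<close>,
  \<open>permute_blocks_inv\<close>), and it permutes the statistics accordingly (\<open>wpk_permute_blocks\<close>).
\<close>

section \<open>Cutting a path at its up-steps\<close>

text \<open>
  The list of the maximal words without up-steps, including the empty ones: a path with \<open>N\<close>
  up-steps has \<open>N + 1\<close> blocks, and the block with index \<open>j\<close> is preceded by \<open>j\<close> up-steps.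
\<close>

fun blocks :: "step list \<Rightarrow> step list list" where
  "blocks [] = [[]]"
| "blocks (Up # P) = [] # blocks P"
| "blocks (s # P) = (s # hd (blocks P)) # tl (blocks P)"

text \<open>The inverse operation: joining words by single up-steps.\<close>

fun unblocks :: "step list list \<Rightarrow> step list" where
  "unblocks [] = []"
| "unblocks [w] = w"
| "unblocks (w # v # ws) = w @ Up # unblocks (v # ws)"

lemma blocks_not_Nil [simp]: "blocks P \<noteq> []"
  by (induction P rule: blocks.induct) auto

lemma Up_notin_blocks: "w \<in> set (blocks P) \<Longrightarrow> Up \<notin> set w"
proof (induction P arbitrary: w rule: blocks.induct)
  case ("3_1" P)
  then show ?case by (cases "blocks P") (use blocks_not_Nil in auto)
next
  case ("3_2" a b P)
  then show ?case by (cases "blocks P") (use blocks_not_Nil in auto)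
qed auto

lemma unblocks_Cons_step: "unblocks ((s # w) # ws) = s # unblocks (w # ws)"
  by (cases ws) auto

lemma unblocks_blocks [simp]: "unblocks (blocks P) = P"
proof (induction P rule: blocks.induct)
  case (2 P)
  then show ?case by (cases "blocks P") auto
next
  case ("3_1" P)
  then show ?case by (simp add: unblocks_Cons_step)
next
  case ("3_2" a b P)
  then show ?case by (simp add: unblocks_Cons_step)
qed auto

lemma blocks_Up_free_append:
  "Up \<notin> set w \<Longrightarrow> blocks (w @ P) = (w @ hd (blocks P)) # tl (blocks P)"
proof (induction w)
  case (Cons s w)
  then show ?case by (cases s) auto
qed simp

lemma blocks_unblocks:
  "ws \<noteq> [] \<Longrightarrow> \<forall>w \<in> set ws. Up \<notin> set w \<Longrightarrow> blocks (unblocks ws) = ws"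
proof (induction ws rule: unblocks.induct)
  case (2 w)
  then show ?case using blocks_Up_free_append[of w "[]"] by simp
qed (auto simp: blocks_Up_free_append)

section \<open>Reading a path off its blocks\<close>

text \<open>The height gained along a word; it may be negative.\<close>

definition height :: "nat \<Rightarrow> step list \<Rightarrow> int" where
  "height k P = snd (sum_list (map (step_vec k) P))"

lemma height_simps [simp]:
  "height k [] = 0"
  "height k (Up # P) = 1 + height k P"
  "height k (Down # P) = height k P - int k"
  "height k (Level a b # P) = height k P"
  "height k (P @ Q) = height k P + height k Q"
  by (simp_all add: height_def)

lemma snd_vertex: "snd (vertex k P j) = height k (take j P)"
  by (simp add: vertex_def height_def)

lemma fst_vertex_nonneg: "0 \<le> fst (vertex k P j)"
proof -
  have "0 \<le> fst (sum_list (map (step_vec k) Q))" for Q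
  proof (induction Q)
    case (Cons s Q)
    then show ?case by (cases s) auto
  qed simp
  then show ?thesis by (simp add: vertex_def)
qed

text \<open>The number of down-steps of a word.\<close>

definition downs :: "step list \<Rightarrow> nat" where
  "downs w = count_list w Down"

text \<open>The number of down-steps in the first \<open>n\<close> blocks.\<close>

definition down_sum :: "step list list \<Rightarrow> nat \<Rightarrow> nat" where
  "down_sum ws n = (\<Sum>j<n. downs (ws ! j))"

lemma down_sum_Cons [simp]: "down_sum (w # ws) (Suc n) = downs w + down_sum ws n"
  by (simp add: down_sum_def sum.lessThan_Suc_shift del: sum.lessThan_Suc)

lemma down_sum_0 [simp]: "down_sum ws 0 = 0"
  by (simp add: down_sum_def)

lemma downs_simps [simp]:
  "downs [] = 0" "downs (Down # w) = Suc (downs w)" "downs (Up # w) = downs w"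
  "downs (Level a b # w) = downs w"
  by (simp_all add: downs_def)

lemma admissible_blocks:
  "(\<forall>s \<in> set P. admissible_step A c s) \<longleftrightarrow>
   (\<forall>w \<in> set (blocks P). \<forall>s \<in> set w. admissible_step A c s)"
proof (induction P rule: blocks.induct)
  case ("3_1" P)
  then show ?case by (cases "blocks P") (use blocks_not_Nil in auto)
next
  case ("3_2" a b P)
  then show ?case by (cases "blocks P") (use blocks_not_Nil in auto)
qed auto

text \<open>
  The path has one up-step fewer than it has blocks; adding one on the left makes the right-hand
  side a sum over blocks, which is insensitive to their order.
\<close>

lemma path_length_blocks:
  "Suc (path_length P) = (\<Sum>j<length (blocks P). Suc (path_length (blocks P ! j)))"
proof -
  have "Suc (path_length P) = sum_list (map (\<lambda>w. Suc (path_length w)) (blocks P))"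
  proof (induction P rule: blocks.induct)
    case ("3_1" P)
    then show ?case by (cases "blocks P") (use blocks_not_Nil in \<open>auto simp: path_length_def\<close>)
  next
    case ("3_2" a b P)
    then show ?case by (cases "blocks P") (use blocks_not_Nil in \<open>auto simp: path_length_def\<close>)
  qed (auto simp: path_length_def)
  then show ?thesis
    by (simp add: sum_list_sum_nth atLeast0LessThan)
qed

lemma height_blocks:
  "height k P = int (length (blocks P)) - 1 - int k * int (down_sum (blocks P) (length (blocks P)))"
proof (induction P rule: blocks.induct)
  case ("3_1" P)
  then show ?case
    by (cases "blocks P") (use blocks_not_Nil in \<open>auto simp: algebra_simps\<close>)
next
  case ("3_2" a b P)
  then show ?case
    by (cases "blocks P") (use blocks_not_Nil in \<open>auto simp: algebra_simps\<close>)
qed (auto simp: algebra_simps)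

lemma all_le_Suc_conv: "(\<forall>j \<le> Suc n. Q j) \<longleftrightarrow> Q 0 \<and> (\<forall>j \<le> n. Q (Suc j))"
  by (metis Suc_le_mono le0 not0_implies_Suc)

text \<open>
  Inside a block the height never increases, so it suffices to test nonnegativity at the end of each
  block. The starting height \<open>h\<close> is arbitrary for the sake of the induction.
\<close>

lemma prefix_nonneg_blocks:
  "0 \<le> h \<Longrightarrow>
   (\<forall>j \<le> length P. 0 \<le> h + height k (take j P)) \<longleftrightarrow>
   (\<forall>i < length (blocks P). int k * int (down_sum (blocks P) (Suc i)) \<le> h + int i)"
proof (induction P arbitrary: h rule: blocks.induct)
  case (2 P)
  have "(\<forall>j \<le> length P. 0 \<le> h + 1 + height k (take j P)) \<longleftrightarrow>
   (\<forall>i < length (blocks P). int k * int (down_sum (blocks P) (Suc i)) \<le> h + 1 + int i)"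
    using 2 by simp
  then show ?case using 2(2)
    by (simp add: all_le_Suc_conv All_less_Suc2 algebra_simps)
next
  case ("3_1" P)
  obtain b bs where bs: "blocks P = b # bs"
    using blocks_not_Nil by (meson neq_Nil_conv)
  show ?case
  proof (cases "int k \<le> h")
    case True
    have "(\<forall>j \<le> length P. 0 \<le> h - int k + height k (take j P)) \<longleftrightarrow>
      (\<forall>i < length (blocks P). int k * int (down_sum (blocks P) (Suc i)) \<le> h - int k + int i)"
      using True by (intro "3_1"(1)) auto
    then show ?thesis using "3_1.prems"
      by (simp add: all_le_Suc_conv bs algebra_simps)
  next
    case False
    \<comment> \<open>The first down-step already leads below the axis, and the first block contains it.\<close>
    have "\<not> (\<forall>j \<le> length (Down # P). 0 \<le> h + height k (take j (Down # P)))"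
      using False by (auto simp: all_le_Suc_conv intro!: exI[of _ 0])
    moreover have "int k * int (down_sum (blocks (Down # P)) (Suc 0)) \<ge> int k"
      by (simp add: bs algebra_simps)
    then have "\<not> (\<forall>i < length (blocks (Down # P)).
        int k * int (down_sum (blocks (Down # P)) (Suc i)) \<le> h + int i)"
      using False by (auto intro!: exI[of _ 0])
    ultimately show ?thesis by blast
  qed
next
  case ("3_2" a b P)
  obtain v vs where "blocks P = v # vs"
    using blocks_not_Nil by (meson neq_Nil_conv)
  then show ?case using "3_2"(1)[OF "3_2.prems"] "3_2.prems"
    by (simp add: all_le_Suc_conv)
qed simp

text \<open>
  Apart from the bound on the number of down-steps in each initial segment, every condition here
  is invariant under permutations of the blocks.
\<close>

lemma mem_paths_iff:
  "P \<in> paths k A c m n \<longleftrightarrow>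
     (\<forall>w \<in> set (blocks P). \<forall>s \<in> set w. admissible_step A c s) \<and>
     (\<forall>i < length (blocks P). k * down_sum (blocks P) (Suc i) \<le> i) \<and>
     length (blocks P) = Suc (k * down_sum (blocks P) (length (blocks P)) + m) \<and>
     (\<Sum>j<length (blocks P). Suc (path_length (blocks P ! j))) = Suc n"
proof -
  have 1: "(\<forall>j\<le>length P. 0 \<le> height k (take j P)) \<longleftrightarrow>
    (\<forall>i < length (blocks P). k * down_sum (blocks P) (Suc i) \<le> i)"
    using prefix_nonneg_blocks[of 0 P k] by (simp flip: of_nat_mult)
  have 2: "height k P = int m \<longleftrightarrow>
    length (blocks P) = Suc (k * down_sum (blocks P) (length (blocks P)) + m)"
  proof -
    have "height k P = int m \<longleftrightarrow>
      int (length (blocks P)) = int (Suc (k * down_sum (blocks P) (length (blocks P)) + m))"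
      by (auto simp: height_blocks)
    then show ?thesis by (simp only: of_nat_eq_iff)
  qed
  show ?thesis
    unfolding paths_def is_path_def mem_Collect_eq
    by (simp add: snd_vertex fst_vertex_nonneg 1 2 flip: admissible_blocks path_length_blocks)
qed

section \<open>Weak peaks as nonempty blocks\<close>

text \<open>
  The positions of the weak peaks with height congruent to \<open>i\<close> in a word that starts at height \<open>h\<close>
  and is at the beginning of a path or preceded by an up-step. Unlike for paths, an initial
  down-step counts here, which is what makes the recursion over blocks uniform.
\<close>

definition peak_set :: "nat \<Rightarrow> nat \<Rightarrow> int \<Rightarrow> step list \<Rightarrow> nat set" where
  "peak_set k i h P = {j. j < length P \<and> P ! j \<noteq> Up \<and> (j = 0 \<or> P ! (j - 1) = Up) \<and>
     [h + height k (take j P) = int i] (mod int k)}"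

text \<open>The indices of the nonempty blocks in the residue class \<open>i\<close>, if the first block is at height \<open>h\<close>.\<close>

definition block_set :: "nat \<Rightarrow> nat \<Rightarrow> int \<Rightarrow> step list list \<Rightarrow> nat set" where
  "block_set k i h ws = {j. j < length ws \<and> ws ! j \<noteq> [] \<and> [h + int j = int i] (mod int k)}"

lemma height_Up_free:
  "Up \<notin> set w \<Longrightarrow> [height k w = 0] (mod int k)"
proof (induction w)
  case (Cons s w)
  then show ?case by (cases s) (auto simp: cong_iff_dvd_diff)
qed simp

lemma peak_set_Up_free:
  assumes "Up \<notin> set w"
  shows "peak_set k i h w = (if w \<noteq> [] \<and> [h = int i] (mod int k) then {0} else {})"
proof -
  have "w ! j \<noteq> Up" if "j < length w" for j
    using assms that nth_mem by metis
  then show ?thesis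
    by (cases w) (auto simp: peak_set_def)
qed

lemma peak_set_append_Up:
  assumes "Up \<notin> set w"
  shows "peak_set k i h (w @ Up # Q) =
    (if w \<noteq> [] \<and> [h = int i] (mod int k) then {0} else {}) \<union>
    (\<lambda>j. Suc (length w + j)) ` peak_set k i (h + 1) Q" (is "?L = ?A \<union> ?f ` ?B")
proof -
  have nU: "w ! j \<noteq> Up" if "j < length w" for j
    using assms that nth_mem by metis
  have shift: "[h + (height k w + (1 + x)) = int i] (mod int k) \<longleftrightarrow>
    [h + 1 + x = int i] (mod int k)" for x
  proof -
    have "[h + (height k w + (1 + x)) = h + 1 + x] (mod int k)"
      using cong_add[OF height_Up_free[OF assms, of k] cong_refl[of "h + 1 + x"]]
      by (simp add: algebra_simps)
    then show ?thesis by (meson cong_sym cong_trans)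
  qed
  have "j \<in> ?L \<longleftrightarrow> j \<in> ?A \<union> ?f ` ?B" for j
  proof (cases "j \<le> length w")
    case True
    have "j \<notin> ?f ` ?B" using True by auto
    moreover have "j \<in> ?L \<longleftrightarrow> j \<in> ?A"
      using True nU[of j] nU[of "j - 1"]
      by (cases "j = length w"; cases "j = 0") (auto simp: peak_set_def nth_append)
    ultimately show ?thesis by blast
  next
    case False
    then obtain t where t: "j = Suc (length w + t)"
      by (metis not_less_eq_eq less_imp_Suc_add not_le)
    have "j \<in> ?L \<longleftrightarrow> t \<in> ?B"
      using shift[of 0] by (cases t) (auto simp: t peak_set_def nth_append shift)
    then show ?thesis by (auto simp: t)
  qed
  then show ?thesis by blast
qed

lemma block_set_Cons:
  "block_set k i h (w # ws) =
    (if w \<noteq> [] \<and> [h = int i] (mod int k) then {0} else {}) \<union>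
    Suc ` block_set k i (h + 1) ws" (is "?L = ?A \<union> ?B")
proof -
  have "j \<in> ?L \<longleftrightarrow> j \<in> ?A \<union> ?B" for j
    by (cases j) (auto simp: block_set_def algebra_simps)
  then show ?thesis by blast
qed

lemma finite_peak_set [simp]: "finite (peak_set k i h P)"
  by (rule finite_subset[of _ "{..<length P}"]) (auto simp: peak_set_def)

lemma finite_block_set [simp]: "finite (block_set k i h P)"
  by (rule finite_subset[of _ "{..<length P}"]) (auto simp: block_set_def)

lemma card_peak_set_unblocks:
  "ws \<noteq> [] \<Longrightarrow> \<forall>w \<in> set ws. Up \<notin> set w \<Longrightarrow>
   card (peak_set k i h (unblocks ws)) = card (block_set k i h ws)"
proof (induction ws arbitrary: h rule: unblocks.induct)
  case (2 w)
  have "block_set k i (h + 1) [] = {}" by (simp add: block_set_def)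
  then show ?case using 2 by (simp add: peak_set_Up_free block_set_Cons)
next
  case (3 w v ws)
  let ?A = "if w \<noteq> [] \<and> [h = int i] (mod int k) then {0::nat} else {}"
  let ?P = "peak_set k i (h + 1) (unblocks (v # ws))"
  let ?B = "block_set k i (h + 1) (v # ws)"
  have "card (peak_set k i h (unblocks (w # v # ws))) =
      card (?A \<union> (\<lambda>j. Suc (length w + j)) ` ?P)"
    using 3(3) peak_set_append_Up[of w k i h "unblocks (v # ws)"] by simp
  also have "\<dots> = card ?A + card ?P"
    by (subst card_Un_disjoint) (auto simp: card_image inj_on_def)
  also have "card ?P = card ?B"
    using 3 by simp
  also have "card ?A + card ?B = card (?A \<union> Suc ` ?B)"
    by (subst card_Un_disjoint) (auto simp: card_image)
  also have "\<dots> = card (block_set k i h (w # v # ws))"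
    by (simp only: block_set_Cons[of k i h w "v # ws"])
  finally show ?case .
qed simp

lemma wpk_eq_card_block_set:
  assumes "k \<ge> 1" "P \<in> paths k A c m n"
  shows "wpk k i P = card (block_set k i 0 (blocks P))"
proof -
  \<comment> \<open>A path starts on the axis, so its first step is not a down-step.\<close>
  have first: "P ! 0 \<noteq> Down" if ne: "P \<noteq> []"
  proof
    assume "P ! 0 = Down"
    then obtain Q where "P = Down # Q" using ne by (cases P) auto
    moreover have "0 \<le> snd (vertex k P 1)" if "1 \<le> length P"
      using assms(2) that unfolding paths_def is_path_def by blast
    ultimately show False using assms(1) by (simp add: snd_vertex)
  qed
  have nUp: "s \<noteq> Up \<longleftrightarrow> s = Down \<or> (\<exists>a b. s = Level a b)" for s
    by (cases s) auto
  have "weak_peak_at P j \<longleftrightarrow> j < length P \<and> P ! j \<noteq> Up \<and> (j = 0 \<or> P ! (j - 1) = Up)" for j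
    using first by (cases j) (auto simp: weak_peak_at_def nUp)
  then have "wpk k i P = card (peak_set k i 0 P)"
    by (simp add: wpk_def peak_set_def snd_vertex conj_assoc)
  also have "\<dots> = card (block_set k i 0 (blocks P))"
    using card_peak_set_unblocks[of "blocks P" k i 0] Up_notin_blocks by force
  finally show ?thesis .
qed

section \<open>Permuting blocks within rows\<close>

text \<open>
  The index \<open>j\<close> lies in row \<open>j div k\<close> and column \<open>j mod k\<close>; \<open>row_perm k \<pi>\<close> applies the
  permutation \<open>\<pi>\<close> of the columns in every row.
\<close>

definition row_perm :: "nat \<Rightarrow> (nat \<Rightarrow> nat) \<Rightarrow> nat \<Rightarrow> nat" where
  "row_perm k \<pi> j = k * (j div k) + \<pi> (j mod k)"

text \<open>The block at index \<open>j\<close> of the new path is the block at index \<open>row_perm k \<pi> j\<close> of the old one.\<close>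

definition permute_blocks :: "nat \<Rightarrow> (nat \<Rightarrow> nat) \<Rightarrow> step list \<Rightarrow> step list" where
  "permute_blocks k \<pi> P = unblocks (permute_list (row_perm k \<pi>) (blocks P))"

text \<open>
  The permutations of the columns are those of a set \<open>T\<close> that lies on one side of the cut between
  the columns \<open>0, \<dots>, r\<close>, which the last row has, and the columns \<open>r + 1, \<dots>, k - 1\<close>, which it
  lacks. Such permutations preserve \<open>{..r}\<close>, and they are closed under inverses.
\<close>

context
  fixes k r :: nat and T :: "nat set"
  assumes r: "r < k" and T: "T \<subseteq> {..r} \<or> T \<subseteq> {r<..<k}"
begin

lemma perm_bounds:
  assumes "\<pi> permutes T"
  shows "x < k \<Longrightarrow> \<pi> x < k" and "x \<le> r \<Longrightarrow> \<pi> x \<le> r"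
proof -
  have "(\<pi> x \<in> T \<longleftrightarrow> x \<in> T) \<and> (x \<notin> T \<longrightarrow> \<pi> x = x)"
    using assms by (simp add: permutes_in_image permutes_not_in)
  with r T show "x < k \<Longrightarrow> \<pi> x < k" and "x \<le> r \<Longrightarrow> \<pi> x \<le> r"
    by (cases "x \<in> T"; force)+
qed

lemma row_perm_div_mod:
  assumes "\<pi> permutes T"
  shows "row_perm k \<pi> j div k = j div k" and "row_perm k \<pi> j mod k = \<pi> (j mod k)"
  using perm_bounds(1)[OF assms, of "j mod k"] r by (auto simp: row_perm_def)

lemma row_perm_inv:
  assumes "\<pi> permutes T"
  shows "row_perm k (inv \<pi>) (row_perm k \<pi> j) = j"
proof -
  have "row_perm k (inv \<pi>) (row_perm k \<pi> j) = k * (j div k) + j mod k"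
    unfolding row_perm_def[of k "inv \<pi>"]
    by (simp add: row_perm_div_mod[OF assms] permutes_inverses(2)[OF assms])
  then show ?thesis by simp
qed

text \<open>This is where the position of \<open>T\<close> matters: the indices of the incomplete last row are permuted
  among themselves.\<close>

lemma row_perm_less:
  assumes "\<pi> permutes T" "N mod k = r" "j \<le> N"
  shows "row_perm k \<pi> j \<le> N"
proof (cases "j div k = N div k")
  case True
  then have "j mod k \<le> r"
    using assms(2,3) by (metis add_le_cancel_left mult_div_mod_eq)
  then have "\<pi> (j mod k) \<le> N mod k"
    using perm_bounds(2)[OF assms(1)] assms(2) by simp
  then show ?thesis
    using True by (metis row_perm_def add_le_cancel_left mult_div_mod_eq)
next
  case False
  then have "row_perm k \<pi> j div k < N div k"
    using assms(3) by (simp add: row_perm_div_mod[OF assms(1)] div_le_mono le_neq_implies_less)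
  then show ?thesis
    by (meson div_le_mono leD le_cases)
qed

lemma bij_row_perm:
  assumes "\<pi> permutes T" "N mod k = r"
  shows "bij_betw (row_perm k \<pi>) {..<Suc N} {..<Suc N}"
proof (rule bij_betw_byWitness[where f' = "row_perm k (inv \<pi>)"])
  have inv: "inv \<pi> permutes T" using assms(1) by (rule permutes_inv)
  show "\<forall>a\<in>{..<Suc N}. row_perm k (inv \<pi>) (row_perm k \<pi> a) = a"
    using row_perm_inv[OF assms(1)] by blast
  show "\<forall>a\<in>{..<Suc N}. row_perm k \<pi> (row_perm k (inv \<pi>) a) = a"
    using row_perm_inv[OF inv] permutes_inv_inv[OF assms(1)] by simp
  show "row_perm k \<pi> ` {..<Suc N} \<subseteq> {..<Suc N}"
    using row_perm_less[OF assms] by (auto simp: less_Suc_eq_le)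
  show "row_perm k (inv \<pi>) ` {..<Suc N} \<subseteq> {..<Suc N}"
    using row_perm_less[OF inv assms(2)] by (auto simp: less_Suc_eq_le)
qed

context
  fixes m l n :: nat and A :: "nat set" and c :: "nat \<Rightarrow> nat" and P :: "step list"
    and \<pi> :: "nat \<Rightarrow> nat"
  assumes m: "m = l * k + r" and P: "P \<in> paths k A c m n" and \<pi>: "\<pi> permutes T"
begin

lemma blocks_bij:
  "bij_betw (row_perm k \<pi>) {..<length (blocks P)} {..<length (blocks P)}"
proof -
  define D where "D = down_sum (blocks P) (length (blocks P))"
  have "length (blocks P) = Suc (k * D + m)"
    using P unfolding mem_paths_iff D_def by blast
  moreover have "(k * D + m) mod k = r"
    using r by (simp add: m)
  ultimately show ?thesis
    using bij_row_perm[OF \<pi>] by simp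
qed

lemma set_permuted_blocks:
  "set (permute_list (row_perm k \<pi>) (blocks P)) = set (blocks P)"
proof -
  have "set (permute_list (row_perm k \<pi>) (blocks P)) =
      (!) (blocks P) ` row_perm k \<pi> ` {..<length (blocks P)}"
    by (auto simp: permute_list_def)
  also have "\<dots> = set (blocks P)"
    unfolding bij_betw_imp_surj_on[OF blocks_bij] by (auto simp: set_conv_nth)
  finally show ?thesis .
qed

lemma blocks_permute_blocks:
  "blocks (permute_blocks k \<pi> P) = permute_list (row_perm k \<pi>) (blocks P)"
  unfolding permute_blocks_def
proof (rule blocks_unblocks)
  show "permute_list (row_perm k \<pi>) (blocks P) \<noteq> []"
    by (simp add: permute_list_def)
  show "\<forall>w\<in>set (permute_list (row_perm k \<pi>) (blocks P)). Up \<notin> set w"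
    using Up_notin_blocks by (auto simp: set_permuted_blocks)
qed

lemma nth_blocks_permute_blocks:
  "j < length (blocks P) \<Longrightarrow>
   blocks (permute_blocks k \<pi> P) ! j = blocks P ! row_perm k \<pi> j"
  by (simp add: blocks_permute_blocks permute_list_def)

lemma length_blocks_permute_blocks:
  "length (blocks (permute_blocks k \<pi> P)) = length (blocks P)"
  by (simp add: blocks_permute_blocks)

lemma sum_blocks_permute_blocks:
  "(\<Sum>j<length (blocks P). f (blocks (permute_blocks k \<pi> P) ! j)) =
   (\<Sum>j<length (blocks P). f (blocks P ! j))"
  using sum.reindex_bij_betw[OF blocks_bij, of "\<lambda>j. f (blocks P ! j)"]
  by (simp add: nth_blocks_permute_blocks)

text \<open>The permuted path stays in the first quadrant.\<close>

lemma down_sum_permute_blocks: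
  assumes "i < length (blocks P)"
  shows "k * down_sum (blocks (permute_blocks k \<pi> P)) (Suc i) \<le> i"
proof -
  let ?\<tau> = "row_perm k \<pi>" and ?L = "length (blocks P)"
  \<comment> \<open>\<open>e\<close> is the last index in the row of \<open>i\<close>; the bounds at \<open>i\<close> and at \<open>e\<close> agree.\<close>
  define e where "e = min (?L - 1) (k * (i div k) + (k - 1))"
  have "e \<le> ?L - 1" by (simp add: e_def)
  with assms have e: "e < ?L" by linarith
  have "e div k \<le> (k * (i div k) + (k - 1)) div k"
    by (rule div_le_mono) (simp add: e_def)
  moreover have "(k * (i div k) + (k - 1)) div k = i div k"
    using r by (intro div_nat_eqI) auto
  ultimately have e_div: "e div k \<le> i div k" by simp
  have sub: "?\<tau> ` {..<Suc i} \<subseteq> {..<Suc e}"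
  proof
    fix x assume "x \<in> ?\<tau> ` {..<Suc i}"
    then obtain j where j: "j \<le> i" "x = ?\<tau> j" by (auto simp: less_Suc_eq_le)
    have "x < ?L"
      using bij_betw_imp_surj_on[OF blocks_bij] j assms by auto
    moreover have "x div k \<le> i div k"
      using j by (simp add: row_perm_div_mod[OF \<pi>] div_le_mono)
    then have "k * (x div k) \<le> k * (i div k)" by simp
    moreover have "x mod k < k" using r by simp
    ultimately have "k * (x div k) + x mod k \<le> k * (i div k) + (k - 1)" by linarith
    then have "x \<le> k * (i div k) + (k - 1)" by simp
    with \<open>x < ?L\<close> show "x \<in> {..<Suc e}" by (auto simp: e_def)
  qed
  have inj: "inj_on ?\<tau> {..<Suc i}"
    using bij_betw_imp_inj_on[OF blocks_bij] by (rule inj_on_subset) (use assms in auto)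
  have "down_sum (blocks (permute_blocks k \<pi> P)) (Suc i) =
      (\<Sum>j<Suc i. downs (blocks P ! ?\<tau> j))"
    unfolding down_sum_def using assms
    by (intro sum.cong) (auto simp: nth_blocks_permute_blocks)
  also have "\<dots> = (\<Sum>x \<in> ?\<tau> ` {..<Suc i}. downs (blocks P ! x))"
    using inj by (simp add: sum.reindex)
  also have "\<dots> \<le> down_sum (blocks P) (Suc e)"
    unfolding down_sum_def using sub by (intro sum_mono2) auto
  finally have le: "down_sum (blocks (permute_blocks k \<pi> P)) (Suc i) \<le> down_sum (blocks P) (Suc e)" .
  have "k * down_sum (blocks P) (Suc e) \<le> e"
    using P e unfolding mem_paths_iff by blast
  then have "down_sum (blocks P) (Suc e) \<le> e div k"
    using r by (simp add: less_eq_div_iff_mult_less_eq mult.commute)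
  with le e_div have "down_sum (blocks (permute_blocks k \<pi> P)) (Suc i) \<le> i div k" by linarith
  then show ?thesis
    using r by (simp add: less_eq_div_iff_mult_less_eq mult.commute)
qed

lemma permute_blocks_in_paths: "permute_blocks k \<pi> P \<in> paths k A c m n"
proof -
  have "down_sum (blocks (permute_blocks k \<pi> P)) (length (blocks P)) =
      down_sum (blocks P) (length (blocks P))"
    unfolding down_sum_def by (rule sum_blocks_permute_blocks)
  moreover have "set (blocks (permute_blocks k \<pi> P)) = set (blocks P)"
    by (simp add: blocks_permute_blocks set_permuted_blocks)
  ultimately show ?thesis
    using P down_sum_permute_blocks sum_blocks_permute_blocks[of "\<lambda>w. Suc (path_length w)"]
    unfolding mem_paths_iff length_blocks_permute_blocks by simp
qed

lemma wpk_permute_blocks: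
  assumes "i < k"
  shows "wpk k i (permute_blocks k \<pi> P) = wpk k (\<pi> i) P"
proof -
  let ?\<tau> = "row_perm k \<pi>" and ?L = "length (blocks P)"
  have set_eq: "block_set k x 0 ws = {j. j < length ws \<and> ws ! j \<noteq> [] \<and> j mod k = x}"
    if "x < k" for x ws
  proof -
    have "[0 + int j = int x] (mod int k) \<longleftrightarrow> j mod k = x" for j
      using that by (simp add: cong_def flip: zmod_int)
    then show ?thesis by (simp add: block_set_def)
  qed
  have "bij_betw ?\<tau> (block_set k i 0 (blocks (permute_blocks k \<pi> P)))
      (block_set k (\<pi> i) 0 (blocks P))"
  proof (rule bij_betw_subset[OF blocks_bij])
    show "block_set k i 0 (blocks (permute_blocks k \<pi> P)) \<subseteq> {..<?L}"
      by (auto simp: block_set_def length_blocks_permute_blocks)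
    have less: "?\<tau> j < ?L" if "j < ?L" for j
      using bij_betw_imp_surj_on[OF blocks_bij] that by auto
    have mod: "?\<tau> j mod k = \<pi> i \<longleftrightarrow> j mod k = i" for j
      using permutes_inj[OF \<pi>] by (simp add: row_perm_div_mod[OF \<pi>] inj_eq)
    have iff: "?\<tau> j \<in> block_set k (\<pi> i) 0 (blocks P) \<longleftrightarrow>
        j \<in> block_set k i 0 (blocks (permute_blocks k \<pi> P))" if "j < ?L" for j
      unfolding set_eq[OF assms] set_eq[OF perm_bounds(1)[OF \<pi> assms]]
      using that less[OF that] mod[of j]
      by (simp add: length_blocks_permute_blocks nth_blocks_permute_blocks)
    have "block_set k (\<pi> i) 0 (blocks P) \<subseteq> ?\<tau> ` {..<?L}"
      unfolding bij_betw_imp_surj_on[OF blocks_bij] by (auto simp: block_set_def)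
    moreover have "block_set k i 0 (blocks (permute_blocks k \<pi> P)) \<subseteq> {..<?L}"
      by (auto simp: block_set_def length_blocks_permute_blocks)
    ultimately show "?\<tau> ` block_set k i 0 (blocks (permute_blocks k \<pi> P)) =
        block_set k (\<pi> i) 0 (blocks P)"
      using iff by blast
  qed
  then have "card (block_set k i 0 (blocks (permute_blocks k \<pi> P))) =
      card (block_set k (\<pi> i) 0 (blocks P))"
    by (rule bij_betw_same_card)
  moreover have "k \<ge> 1" using r by simp
  ultimately show ?thesis
    using P permute_blocks_in_paths by (simp add: wpk_eq_card_block_set)
qed

end

lemma permute_blocks_inv:
  assumes "m = l * k + r" "P \<in> paths k A c m n" "\<pi> permutes T"
  shows "permute_blocks k (inv \<pi>) (permute_blocks k \<pi> P) = P"
proof -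
  have inv: "inv \<pi> permutes T" using assms(3) by (rule permutes_inv)
  note bij = blocks_bij[OF assms] blocks_bij[OF assms(1,2) inv]
  have less: "row_perm k (inv \<pi>) j < length (blocks P)" if "j < length (blocks P)" for j
    using bij_betw_imp_surj_on[OF bij(2)] that by auto
  have "permute_list (row_perm k (inv \<pi>)) (permute_list (row_perm k \<pi>) (blocks P)) = blocks P"
    using less row_perm_inv[OF inv] permutes_inv_inv[OF assms(3)]
    by (intro nth_equalityI) (auto simp: permute_list_def)
  then show ?thesis
    by (simp add: permute_blocks_def[of k "inv \<pi>"] blocks_permute_blocks[OF assms])
qed

lemma card_wpk_permute:
  assumes "m = l * k + r" "\<pi> permutes T" "I \<subseteq> {..<k}"
  shows "card {P \<in> paths k A c m n. \<forall>i \<in> I. int (wpk k i P) = v i} =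
         card {P \<in> paths k A c m n. \<forall>i \<in> I. int (wpk k (\<pi> i) P) = v i}" (is "card ?X = card ?Y")
proof -
  have inv: "inv \<pi> permutes T" using assms(2) by (rule permutes_inv)
  have "bij_betw (permute_blocks k \<pi>) ?Y ?X"
  proof (rule bij_betw_byWitness[where f' = "permute_blocks k (inv \<pi>)"])
    show "\<forall>P\<in>?Y. permute_blocks k (inv \<pi>) (permute_blocks k \<pi> P) = P"
      using permute_blocks_inv[OF assms(1) _ assms(2)] by blast
    show "\<forall>P\<in>?X. permute_blocks k \<pi> (permute_blocks k (inv \<pi>) P) = P"
      using permute_blocks_inv[OF assms(1) _ inv] permutes_inv_inv[OF assms(2)] by auto
    show "permute_blocks k \<pi> ` ?Y \<subseteq> ?X"
      using assms(3) permute_blocks_in_paths[OF assms(1) _ assms(2)]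
        wpk_permute_blocks[OF assms(1) _ assms(2)] by (auto simp: subset_iff)
    have "\<pi> i < k" if "i \<in> I" for i
      using that assms(3) perm_bounds(1)[OF assms(2)] by auto
    then show "permute_blocks k (inv \<pi>) ` ?X \<subseteq> ?Y"
      using permute_blocks_in_paths[OF assms(1) _ inv]
        wpk_permute_blocks[OF assms(1) _ inv] permutes_inverses(2)[OF assms(2)]
      by auto
  qed
  then show ?thesis using bij_betw_same_card by fastforce
qed

end

section \<open>Joint equidistribution\<close>

lemma permutes_shift:
  fixes \<sigma> :: "nat \<Rightarrow> nat"
  assumes "\<sigma> permutes {..<p}"
  shows "(\<lambda>x. if x < a then x else a + \<sigma> (x - a)) permutes {a..<a + p}"
proof -
  let ?s = "\<lambda>\<sigma> x. if x < a then x else a + \<sigma> (x - a)"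
  have "bij (?s \<sigma>)"
    by (rule o_bij[of "?s (inv \<sigma>)"]) (auto simp: permutes_inverses[OF assms])
  moreover have "\<forall>x. x \<notin> {a..<a + p} \<longrightarrow> ?s \<sigma> x = x"
    using permutes_not_in[OF assms] by auto
  ultimately show ?thesis
    unfolding permutes_def bij_iff by blast
qed

lemma jointly_equidistributed_wpk_interval:
  assumes "r < k" "m = l * k + r"
    and T: "{a..<a + p} \<subseteq> {..r} \<or> {a..<a + p} \<subseteq> {r<..<k}"
  shows "jointly_equidistributed (map (\<lambda>i P. int (wpk k i P)) [a..<a + p]) (paths k A c m n)"
  unfolding jointly_equidistributed_def
proof (intro allI impI)
  fix \<sigma> and v :: "nat \<Rightarrow> int"
  let ?ss = "map (\<lambda>i P. int (wpk k i P)) [a..<a + p]"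
  assume "\<sigma> permutes {..<length ?ss}"
  then have \<sigma>: "\<sigma> permutes {..<p}" by simp
  let ?\<pi> = "\<lambda>x. if x < a then x else a + \<sigma> (x - a)"
  have sub: "{a..<a + p} \<subseteq> {..<k}" using T assms(1) by auto
  have less: "\<sigma> j < p" if "j < p" for j
    using permutes_in_image[OF \<sigma>, of j] that by simp
  have all: "(\<forall>i \<in> {a..<a + p}. Q i) \<longleftrightarrow> (\<forall>j < p. Q (a + j))" for Q
    by (metis add_diff_inverse_nat atLeastLessThan_iff le_add1 nat_add_left_cancel_less not_le)
  have "card {P \<in> paths k A c m n. \<forall>i \<in> {a..<a + p}. int (wpk k i P) = v (i - a)} =
        card {P \<in> paths k A c m n. \<forall>i \<in> {a..<a + p}. int (wpk k (?\<pi> i) P) = v (i - a)}"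
    using card_wpk_permute[OF assms(1) T assms(2) permutes_shift[OF \<sigma>] sub,
        of A c n "\<lambda>i. v (i - a)"] .
  then show "card {P \<in> paths k A c m n. \<forall>j < length ?ss. (?ss ! j) P = v j} =
      card {P \<in> paths k A c m n. \<forall>j < length ?ss. (?ss ! \<sigma> j) P = v j}"
    unfolding all by (simp add: less cong: conj_cong)
qed

theorem theorem3p5:
  fixes k n m l r :: nat and A :: "nat set" and c :: "nat \<Rightarrow> nat"
  assumes "k \<ge> 1"
    and "\<forall>a \<in> A. a > 0"
    and "\<forall>a \<ge> 1. c a = 0 \<longleftrightarrow> a \<notin> A"
    and "r \<le> k - 1"
    and "m = l * k + r"
  shows "jointly_equidistributed (map (\<lambda>i P. int (wpk k i P)) [0..<r + 1]) (paths k A c m n) \<and>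
         jointly_equidistributed (map (\<lambda>i P. int (wpk k i P)) [r + 1..<k]) (paths k A c m n)"
proof -
  have r: "r < k" using assms(1,4) by simp
  have "jointly_equidistributed (map (\<lambda>i P. int (wpk k i P)) [0..<0 + (r + 1)]) (paths k A c m n)"
    by (rule jointly_equidistributed_wpk_interval[OF r assms(5)]) auto
  moreover have "jointly_equidistributed
      (map (\<lambda>i P. int (wpk k i P)) [r + 1..<r + 1 + (k - (r + 1))]) (paths k A c m n)"
    by (rule jointly_equidistributed_wpk_interval[OF r assms(5)]) auto
  ultimately show ?thesis using r by simp
qed

end
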